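(* Let $n,k,l,r$ be integers with $k,r\geq 2$ and $n\geq l\geq t+1$, where $t=t(k,r)$. Let $p,q\geq 0$ be the integers with $n=p(l-1)+q$ and $0\leq q<l-1$, and let $s=s(k,r)$. Then every star-like-$(k,l)$ $r$-uniform hypergraph $H$ on $n$ vertices satisfies \[ |E(H)|\leq \begin{cases} p\binom{l-1}{r}+pk+\binom{q}{r}, & \text{if } l-1>s \text{ and } q>s,\\ p\binom{l-1}{r}+(p-1+q)k, & \text{if } l-1>s \text{ and } q\leq s,\\ \binom{l-1}{r}+(n-l+1)k, & \text{if } l-1\leq s, \end{cases} \] (the right-hand side being the common number of edges of the hypergraphs in $MSH(n;k,l,r)$).
   Context: A hypergraph $H=(V,E)$ has a finite vertex set $V$ and a set $E$ of nonempty subsets of $V$; it is $r$-uniform if every edge has exactly $r$ elements. $K_m^r$ is the complete $r$-uniform hypergraph on $m$ vertices, $K_1$ a single vertex. Binomial coefficients are $0$ when the lower index exceeds the upper. For $k,r\geq2$, $t=t(k,r)$ is the integer with $\binom{t-1}{r-1}\leq k<\binom{t}{r-1}$, and $s=s(k,r)$ is the largest integer with $k+\binom{s}{r}\leq ks$. Star-like-$(k,l)$ $r$-uniform hypergraphs: start with a copy of $K_{l-1}^r$ (the nucleus); attach to it any number of vertex-disjoint satellites, each being either a single vertex $K_1$ or a copy of $K_i^r$ with $r\leq i\leq l-1$, where each satellite is attached by adding exactly $k$ new edges, each an $r$-subset of the union of the satellite's and the nucleus's vertex sets meeting both. $MSH(n;k,l,r)$: with $n=p(l-1)+q$, $0\le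 q<l-1$: if $l-1>s$, nucleus and $p-1$ satellites are $K_{l-1}^r$, plus one satellite $K_q^r$ if $q>s$, or $q$ satellites $K_1$ if $q\le s$; if $l-1\le s$, nucleus $K_{l-1}^r$ with $n-l+1$ satellites $K_1$; each satellite attached by $k$ edges. *)

theory Defs
  imports Main "HOL-Library.Multiset" "HOL-Library.Disjoint_Sets"
begin

definition hypergraph :: "'a set \<Rightarrow> 'a set set \<Rightarrow> bool" where
  "hypergraph V E \<longleftrightarrow> finite V \<and> (\<forall>e\<in>E. e \<noteq> {} \<and> e \<subseteq> V)"

definition uniform_hypergraph :: "nat \<Rightarrow> 'a set \<Rightarrow> 'a set set \<Rightarrow> bool" where
  "uniform_hypergraph r V E \<longleftrightarrow> hypergraph V E \<and> (\<forall>e\<in>E. card e = r)"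

text \<open>Edge set of the copy of the complete \<open>r\<close>-uniform hypergraph with vertex set \<open>S\<close>.
  For \<open>r \<ge> 2\<close> and a singleton \<open>S\<close> it is empty, so that the copy is then the
  single vertex \<open>K_1\<close>.\<close>

definition complete_edges :: "nat \<Rightarrow> 'a set \<Rightarrow> 'a set set" where
  "complete_edges r S = {e. e \<subseteq> S \<and> card e = r}"

definition attaching_edges :: "nat \<Rightarrow> 'a set \<Rightarrow> 'a set \<Rightarrow> 'a set set" where
  "attaching_edges r N S =
     {e. e \<subseteq> S \<union> N \<and> card e = r \<and> e \<inter> S \<noteq> {} \<and> e \<inter> N \<noteq> {}}"

text \<open>\<open>(V, E)\<close> consists of a complete nucleus on \<open>N\<close>, pairwise disjoint complete
  satellites on the members of \<open>SS\<close>, and, for each satellite \<open>S\<close>, a set \<open>A S\<close> of exactly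
  \<open>k\<close> edges attaching it to the nucleus. The sizes of the nucleus and of the satellites
  are not restricted here.\<close>

definition star_built ::
  "nat \<Rightarrow> nat \<Rightarrow> 'a set \<Rightarrow> 'a set set \<Rightarrow> 'a set \<Rightarrow> 'a set set \<Rightarrow> bool" where
  "star_built k r V E N SS \<longleftrightarrow>
     uniform_hypergraph r V E \<and>
     V = N \<union> \<Union>SS \<and> disjoint SS \<and> N \<inter> \<Union>SS = {} \<and> {} \<notin> SS \<and>
     (\<exists>A. (\<forall>S\<in>SS. A S \<subseteq> attaching_edges r N S \<and> card (A S) = k) \<and>
          E = complete_edges r N \<union> (\<Union>S\<in>SS. complete_edges r S \<union> A S))"

definition star_like :: "nat \<Rightarrow> nat \<Rightarrow> nat \<Rightarrow> 'a set \<Rightarrow> 'a set set \<Rightarrow> bool" where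
  "star_like k l r V E \<longleftrightarrow>
     (\<exists>N SS. star_built k r V E N SS \<and> card N = l - 1 \<and>
       (\<forall>S\<in>SS. card S = 1 \<or> (r \<le> card S \<and> card S \<le> l - 1)))"

definition t_param :: "nat \<Rightarrow> nat \<Rightarrow> nat" where
  "t_param k r = (THE t. (t - 1) choose (r - 1) \<le> k \<and> k < t choose (r - 1))"

definition s_param :: "nat \<Rightarrow> nat \<Rightarrow> nat" where
  "s_param k r = (GREATEST s. k + (s choose r) \<le> k * s)"

text \<open>Membership of \<open>(V, E)\<close> in \<open>MSH(n; k, l, r)\<close>. The satellites are prescribed through
  the multiset of their sizes.\<close>

definition MSH ::
  "nat \<Rightarrow> nat \<Rightarrow> nat \<Rightarrow> nat \<Rightarrow> 'a set \<Rightarrow> 'a set set \<Rightarrow> bool" where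
  "MSH n k l r V E \<longleftrightarrow>
     (\<exists>N SS. star_built k r V E N SS \<and> card N = l - 1 \<and>
       (let p = n div (l - 1); q = n mod (l - 1); s = s_param k r;
            sizes = image_mset card (mset_set SS)
        in if l - 1 > s
           then if q > s
                then sizes = replicate_mset (p - 1) (l - 1) + {#q#}
                else sizes = replicate_mset (p - 1) (l - 1) + replicate_mset q 1
           else sizes = replicate_mset (n - l + 1) 1))"

end

theory Submission imports Defs begin

text \<open>A star-like hypergraph with satellites of sizes \<open>a\<^sub>i\<close> has
  \<open>C(l-1,r) + \<Sum>\<^sub>i (k + C(a\<^sub>i,r))\<close> edges. The summand is bounded by the function \<open>g\<close> with
  \<open>g(0) = 0\<close> and \<open>g(a) = max (k a) (k + C(a,r))\<close> for \<open>a \<ge> 1\<close>, which is convex on the naturals.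
  Given \<open>a\<^sub>i \<le> l-1\<close> and the value of \<open>\<Sum>\<^sub>i a\<^sub>i\<close>, convexity makes \<open>\<Sum>\<^sub>i g(a\<^sub>i)\<close> largest when all
  but one of the nonzero \<open>a\<^sub>i\<close> equal \<open>l-1\<close>. The parameter \<open>s\<close> is the threshold at which the
  maximum in \<open>g\<close> switches from \<open>k a\<close>, attained by \<open>a\<close> single-vertex satellites,
  to \<open>k + C(a,r)\<close>, attained by one complete satellite.\<close>

section \<open>Extremal sums of a convex function on the naturals\<close>

text \<open>The increments of \<open>g\<close> are nondecreasing, so \<open>d\<close> further units
  gain at least as much on top of \<open>y\<close> as on top of \<open>x\<close>. The additive form
  avoids truncated subtraction.\<close>

lemma convex_nat_exchange:
  fixes g :: "nat \<Rightarrow> nat"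
  assumes convex: "\<And>a. 2 * g (Suc a) \<le> g a + g (Suc (Suc a))" and "x \<le> y"
  shows "g (x + d) + g y \<le> g x + g (y + d)"
proof -
  have incr: "g (Suc u) + g (u + j) \<le> g u + g (Suc (u + j))" for u j
  proof (induction j)
    case (Suc j)
    then show ?case using convex[of "u + j"] by simp
  qed simp
  have step: "g (Suc u) + g v \<le> g u + g (Suc v)" if "u \<le> v" for u v
    using incr[of u "v - u"] that by simp
  show ?thesis
  proof (induction d)
    case (Suc d)
    then show ?case using step[of "x + d" "y + d"] \<open>x \<le> y\<close> by simp
  qed simp
qed

text \<open>Greedy packing: the summands are poured one at a time into a bin of capacity
  \<open>m\<close> holding the current remainder; each filled bin contributes
  \<open>g m\<close>.\<close>

lemma convex_sum_le:
  fixes g a :: "_ \<Rightarrow> nat"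
  assumes convex: "\<And>a. 2 * g (Suc a) \<le> g a + g (Suc (Suc a))" and g0: "g 0 = 0"
    and "m > 0" and "finite I" and "\<And>i. i \<in> I \<Longrightarrow> a i \<le> m"
  shows "(\<Sum>i\<in>I. g (a i)) \<le> (sum a I div m) * g m + g (sum a I mod m)"
  using assms(4,5)
proof (induction I rule: finite_induct)
  case empty
  then show ?case by simp
next
  case (insert i I)
  define P q where "P = sum a I div m" and "q = sum a I mod m"
  have sumI: "sum a I = q + P * m" and q: "q < m"
    using \<open>m > 0\<close> by (simp_all add: P_def q_def)
  have ai: "a i \<le> m" using insert.prems by simp
  have IH: "(\<Sum>i\<in>I. g (a i)) \<le> P * g m + g q"
    using insert by (simp add: P_def q_def)
  have total: "sum a (insert i I) = a i + q + P * m"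
    using insert.hyps sumI by simp
  show ?case
  proof (cases "a i + q < m")
    case True
    then have "sum a (insert i I) div m = P" "sum a (insert i I) mod m = a i + q"
      using \<open>m > 0\<close> by (simp_all add: total)
    \<comment> \<open>No overflow: the exchange from base point 0, with \<open>g 0 = 0\<close>, is
      superadditivity.\<close>
    moreover have "g (a i) + g q \<le> g (a i + q)"
      using convex_nat_exchange[of g 0 q "a i"] convex g0 by (simp add: add.commute)
    ultimately show ?thesis using IH insert.hyps by simp
  next
    case False
    \<comment> \<open>Overflow: the pair \<open>(a i, q)\<close> is pushed apart to
      \<open>(x, m)\<close>, which has the same sum.\<close>
    define x where "x = a i + q - m"
    have x: "x \<le> q" "x < m" "a i = x + (m - q)" using False ai q by (auto simp: x_def)
    have "sum a (insert i I) = x + Suc P * m"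
      using total x q by simp
    then have "sum a (insert i I) div m = Suc P" "sum a (insert i I) mod m = x"
      using x(2) by (simp_all del: mult_Suc)
    moreover have "g (a i) + g q \<le> g x + g m"
      using convex_nat_exchange[of g x q "m - q"] convex x q by simp
    ultimately show ?thesis using IH insert.hyps by simp
  qed
qed

section \<open>Convexity of the satellite bound\<close>

text \<open>The second difference of \<open>a choose r\<close> in \<open>a\<close> is
  \<open>a choose (r - 2)\<close>.\<close>

lemma binomial_convex:
  assumes "r \<ge> 2"
  shows "2 * (Suc a choose r) \<le> (a choose r) + (Suc (Suc a) choose r)"
proof -
  obtain j where "r = Suc (Suc j)"
    using assms by (metis add_2_eq_Suc le_Suc_ex)
  then show ?thesis by simp
qed

text \<open>This turns a lower bound on a binomial coefficient into one on its next increment, which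
  drives the threshold argument for \<open>s_param\<close>.\<close>

lemma binomial_Suc_le:
  assumes "r \<ge> 1"
  shows "(Suc a choose Suc r) \<le> a * (Suc a choose r)"
proof (induction a)
  case 0
  then show ?case using assms by simp
next
  case (Suc a)
  have "(Suc (Suc a) choose Suc r) = (Suc a choose r) + (Suc a choose Suc r)" by simp
  also have "\<dots> \<le> Suc a * (Suc a choose r)" using Suc by simp
  also have "\<dots> \<le> Suc a * (Suc (Suc a) choose r)"
    by (intro mult_le_mono2 binomial_right_mono) simp
  finally show ?case .
qed

text \<open>The function \<open>g\<close> of the outline. For \<open>r \<ge> 2\<close> the maximum
  would be \<open>k\<close> at 0, but an absent leftover satellite contributes no edges.\<close>

definition satellite_max :: "nat \<Rightarrow> nat \<Rightarrow> nat \<Rightarrow> nat" where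
  "satellite_max k r a = (if a = 0 then 0 else max (k * a) (k + (a choose r)))"

text \<open>A maximum of two convex functions is convex, so each term at \<open>Suc a\<close> is
  bounded separately. Near the special value at 0 the values are 0, \<open>k\<close> and at least
  \<open>2 * k\<close>.\<close>

lemma satellite_max_convex:
  assumes "r \<ge> 2"
  shows "2 * satellite_max k r (Suc a) \<le> satellite_max k r a + satellite_max k r (Suc (Suc a))"
proof (cases "a = 0")
  case True
  then have "satellite_max k r (Suc a) = k"
    using assms by (simp add: satellite_max_def binomial_eq_0)
  then show ?thesis using True by (simp add: satellite_max_def)
next
  case False
  have "2 * (k * Suc a) \<le> satellite_max k r a + satellite_max k r (Suc (Suc a))"
  proof -
    have "k * a \<le> satellite_max k r a" "k * Suc (Suc a) \<le> satellite_max k r (Suc (Suc a))"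
      using False by (simp_all add: satellite_max_def)
    then show ?thesis by simp
  qed
  moreover have "2 * (k + (Suc a choose r)) \<le> satellite_max k r a + satellite_max k r (Suc (Suc a))"
  proof -
    have "k + (a choose r) \<le> satellite_max k r a"
         "k + (Suc (Suc a) choose r) \<le> satellite_max k r (Suc (Suc a))"
      using False by (simp_all add: satellite_max_def)
    moreover have "2 * (k + y) \<le> u + v" if "k + x \<le> u" "k + z \<le> v" "2 * y \<le> x + z"
      for x y z u v :: nat
      using that by presburger
    ultimately show ?thesis using binomial_convex[OF assms] by blast
  qed
  ultimately show ?thesis by (simp add: satellite_max_def[of k r "Suc a"] max_def)
qed

section \<open>The threshold \<open>s\<close>\<close>

lemma le_binomial:
  fixes n k :: nat
  assumes "1 \<le> k" and "k < n"
  shows "n \<le> n choose k"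
  using assms(2)
proof (induction n)
  case (Suc n)
  obtain j where k: "k = Suc j" using assms(1) by (cases k) auto
  show ?case
  proof (cases "k < n")
    case True
    then have "n choose j > 0" using k by simp
    then show ?thesis using Suc.IH[OF True] unfolding k binomial_Suc_Suc by linarith
  next
    case False
    then show ?thesis using Suc.prems by (simp add: less_Suc_eq)
  qed
qed simp

text \<open>Supplies the bound that makes \<open>GREATEST\<close> meaningful. By absorption,
  \<open>r * (a choose r) = a * ((a - 1) choose (r - 1))\<close>, which is at least
  \<open>a * (a - 1)\<close> for large \<open>a\<close> and so outgrows
  \<open>r * k * a\<close>.\<close>

lemma binomial_above_linear_bounded:
  assumes "r \<ge> 2" and "k + (a choose r) \<le> k * a" and "k > 0"
  shows "a \<le> k * r + r"
proof (rule ccontr)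
  assume "\<not> ?thesis"
  then have a: "a > k * r + r" by simp
  then obtain b where b: "a = Suc b" by (cases a) auto
  obtain j where j: "r = Suc j" "j \<ge> 1" using assms(1) by (cases r) auto
  have "j < b" using a b j by simp
  then have "b choose j \<ge> b" using le_binomial j by blast
  moreover have "Suc j * (a choose r) = a * (b choose j)"
    using Suc_times_binomial_eq[of b j] b j by simp
  ultimately have "a * b \<le> r * (a choose r)" using j by simp
  moreover have "r * (a choose r) < r * (k * a)" using assms by (intro mult_less_mono2) auto
  ultimately have "a * b < r * (k * a)" by (rule le_less_trans)
  also have "\<dots> = a * (k * r)" by (simp add: ac_simps)
  finally have "a * b < a * (k * r)" .
  then have "b < k * r" by (simp only: mult_less_cancel1)
  then show False using a b assms(1) by simp
qed

text \<open>Being the greatest solution is not enough: the positive solutions must form an initial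
  segment, so failure has to persist upwards. At \<open>a = 0\<close> the inequality fails although
  \<open>0 \<le> s\<close>.\<close>

lemma s_param_iff:
  assumes "k > 0" and "r \<ge> 2" and "a \<ge> 1"
  shows "k + (a choose r) \<le> k * a \<longleftrightarrow> a \<le> s_param k r"
proof -
  let ?P = "\<lambda>a. k + (a choose r) \<le> k * a"
  have bound: "\<And>a. ?P a \<Longrightarrow> a \<le> k * r + r"
    using binomial_above_linear_bounded assms by blast
  have "?P 1" using assms by simp
  then have s: "?P (s_param k r)"
    unfolding s_param_def by (rule GreatestI_nat) (use bound in blast)
  \<comment> \<open>Failure at \<open>a = Suc b\<close> means \<open>k * b < a choose r\<close>.
    Cancelling \<open>b\<close> gives \<open>k < a choose (r - 1)\<close>, so the next increment of
    the binomial exceeds that of \<open>k * a\<close>.\<close>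
  have upward: "\<not> ?P (Suc a)" if above: "\<not> ?P a" "a \<ge> 1" for a
  proof -
    obtain b where b: "a = Suc b" using above(2) by (cases a) auto
    obtain j where j: "r = Suc j" "j \<ge> 1" using assms(2) by (cases r) auto
    have "k * b < a choose r"
      using above(1) unfolding b by (simp only: mult_Suc_right not_le add_less_cancel_left)
    also have "\<dots> \<le> b * (a choose j)"
      using binomial_Suc_le[OF j(2), of b] by (simp only: b j(1))
    also have "\<dots> = (a choose j) * b" by (rule mult.commute)
    finally have "k < a choose j" by (simp only: mult_less_cancel2)
    then show ?thesis using above(1) by (simp add: j(1))
  qed
  have persist: "\<not> ?P (a + d)" if "\<not> ?P a" for d
  proof (induction d)
    case (Suc d)
    then show ?case using upward[of "a + d"] assms by simp
  qed (use that in simp)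
  have "?P a" if "a \<le> s_param k r"
    using s that persist[of "s_param k r - a"] by fastforce
  moreover have "a \<le> s_param k r" if "?P a"
    unfolding s_param_def by (rule Greatest_le_nat[where b = "k * r + r"]) (use that bound in blast)+
  ultimately show ?thesis by blast
qed

text \<open>The value 0 at \<open>a = 0\<close> agrees with \<open>k * a\<close>, so the threshold
  form covers \<open>a = 0\<close> too.\<close>

lemma satellite_max_eq:
  assumes "k > 0" and "r \<ge> 2"
  shows "satellite_max k r a = (if a \<le> s_param k r then k * a else k + (a choose r))"
  using s_param_iff[OF assms, of a] by (auto simp: satellite_max_def max_def)

section \<open>Counting vertices and edges\<close>

lemma card_complete_edges:
  assumes "finite S"
  shows "card (complete_edges r S) = card S choose r"
  using n_subsets[OF assms] by (simp add: complete_edges_def)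

text \<open>The counts add up without overlap: every edge belonging to a satellite \<open>S\<close>
  meets \<open>S\<close> and lies in \<open>N \<union> S\<close>, while nucleus edges meet no
  satellite.\<close>

lemma star_built_card:
  assumes "star_built k r V E N SS" and "r \<ge> 1"
  shows "finite SS" and "card V = card N + (\<Sum>S\<in>SS. card S)"
    and "card E = (card N choose r) + (\<Sum>S\<in>SS. k + (card S choose r))"
proof -
  from assms(1) obtain A where uniform: "uniform_hypergraph r V E"
    and V: "V = N \<union> \<Union>SS" and dis: "disjoint SS" and N: "N \<inter> \<Union>SS = {}"
    and A: "\<And>S. S \<in> SS \<Longrightarrow> A S \<subseteq> attaching_edges r N S \<and> card (A S) = k"
    and E: "E = complete_edges r N \<union> (\<Union>S\<in>SS. complete_edges r S \<union> A S)"
    unfolding star_built_def by blast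
  have "finite V" using uniform by (simp add: uniform_hypergraph_def hypergraph_def)
  then have finN: "finite N" and fin: "finite SS" and finS: "\<And>S. S \<in> SS \<Longrightarrow> finite S"
    using V finite_UnionD by (auto intro: finite_subset)
  show "finite SS" by (rule fin)
  show "card V = card N + (\<Sum>S\<in>SS. card S)"
    using V N finN fin finS dis
    by (simp add: card_Un_disjoint card_Union_disjoint disjoint_def pairwise_def)
  have finE: "finite E"
    using uniform \<open>finite V\<close> unfolding uniform_hypergraph_def hypergraph_def
    by (meson PowI finite_Pow_iff finite_subset subsetI)
  have meets: "e \<inter> S \<noteq> {}" and inside: "e \<subseteq> N \<union> S"
    if "e \<in> complete_edges r S \<union> A S" "S \<in> SS" for e S
  proof -
    \<comment> \<open>Here \<open>r \<ge> 1\<close> rules out the empty set as an edge of a complete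
      copy.\<close>
    have "e \<noteq> {} \<and> e \<subseteq> S \<or> e \<in> attaching_edges r N S"
      using that A[OF that(2)] assms(2) by (auto simp: complete_edges_def)
    then show "e \<inter> S \<noteq> {}" "e \<subseteq> N \<union> S" by (auto simp: attaching_edges_def)
  qed
  have disjS: "S \<inter> T = {}" if "S \<in> SS" "T \<in> SS" "S \<noteq> T" for S T
    using dis that by (simp add: disjoint_def)
  have edges_disjoint: "(complete_edges r S \<union> A S) \<inter> (complete_edges r T \<union> A T) = {}"
    if "S \<in> SS" "T \<in> SS" "S \<noteq> T" for S T
  proof -
    have "e \<inter> S = {}" if "e \<in> complete_edges r T \<union> A T" for e
      using inside[OF that \<open>T \<in> SS\<close>] disjS[OF \<open>S \<in> SS\<close> \<open>T \<in> SS\<close> \<open>S \<noteq> T\<close>] N \<open>S \<in> SS\<close> by blast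
    then show ?thesis using meets[OF _ \<open>S \<in> SS\<close>] by blast
  qed
  have satellite: "card (complete_edges r S \<union> A S) = k + (card S choose r)" if "S \<in> SS" for S
  proof -
    have "complete_edges r S \<inter> A S = {}"
    proof -
      have "S \<inter> N = {}" using N that by blast
      then have "e \<notin> attaching_edges r N S" if "e \<in> complete_edges r S" for e
        using that by (auto simp: complete_edges_def attaching_edges_def)
      then show ?thesis using A[OF that] by blast
    qed
    moreover have "complete_edges r S \<subseteq> E" "A S \<subseteq> E" using E that by blast+
    then have "finite (complete_edges r S)" "finite (A S)"
      using finE finite_subset by blast+
    ultimately show ?thesis
      using A[OF that] finS[OF that] by (simp add: card_Un_disjoint card_complete_edges)
  qed
  have "complete_edges r N \<inter> (\<Union>S\<in>SS. complete_edges r S \<union> A S) = {}"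
  proof -
    have "e \<notin> complete_edges r N" if "S \<in> SS" "e \<in> complete_edges r S \<union> A S" for e S
      using meets[OF that(2,1)] N that(1) by (auto simp: complete_edges_def)
    then show ?thesis by blast
  qed
  then have "card E = card (complete_edges r N) + card (\<Union>S\<in>SS. complete_edges r S \<union> A S)"
    using finE unfolding E by (intro card_Un_disjoint) auto
  also have "card (\<Union>S\<in>SS. complete_edges r S \<union> A S) = (\<Sum>S\<in>SS. card (complete_edges r S \<union> A S))"
    using fin finE E edges_disjoint by (intro card_UN_disjoint) (auto intro: finite_subset)
  finally show "card E = (card N choose r) + (\<Sum>S\<in>SS. k + (card S choose r))"
    using finN satellite by (simp add: card_complete_edges)
qed

section \<open>The upper bound and its attainment\<close>

theorem theorem3p1:
  fixes n k l r p q s :: nat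
  assumes "k \<ge> 2" and "r \<ge> 2"
    and "n \<ge> l" and "l \<ge> t_param k r + 1"
    and "n = p * (l - 1) + q" and "q < l - 1"
    and "s = s_param k r"
  shows
    "let b = (if l - 1 > s \<and> q > s then p * ((l - 1) choose r) + p * k + (q choose r)
              else if l - 1 > s \<and> q \<le> s then p * ((l - 1) choose r) + (p - 1 + q) * k
              else ((l - 1) choose r) + (n - l + 1) * k)
     in (\<forall>(V :: 'a set) E. star_like k l r V E \<and> card V = n \<longrightarrow> card E \<le> b) \<and>
        (\<forall>(V :: 'a set) E. MSH n k l r V E \<longrightarrow> card E = b)"
proof -
  define m where "m = l - 1"
  define b where "b = (if m > s \<and> q > s then p * (m choose r) + p * k + (q choose r)
              else if m > s \<and> q \<le> s then p * (m choose r) + (p - 1 + q) * k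
              else (m choose r) + (n - l + 1) * k)"
  have k: "k > 0" and r1: "r \<ge> 1" and m0: "m > 0" and q: "q < m"
    and n: "n = p * m + q" and nl: "n - l + 1 = n - m" and mn: "m \<le> n"
    using assms by (auto simp: m_def)
  \<comment> \<open>One of the \<open>p\<close> blocks of size \<open>m\<close> is the nucleus;
    \<open>P\<close> blocks and the remainder \<open>q\<close> are left for the satellites.\<close>
  obtain P where p: "p = Suc P" using n q mn by (cases p) auto
  have nm: "n - m = P * m + q" using n p by simp
  have max_eq: "satellite_max k r a = (if a \<le> s then k * a else k + (a choose r))" for a
    using satellite_max_eq[OF k assms(2)] assms(7) by simp
  \<comment> \<open>All three cases collapse into one formula; when \<open>m \<le> s\<close>, also
    \<open>q < s\<close>, and both values of \<open>satellite_max\<close> are linear.\<close>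
  have b_eq: "b = (m choose r) + (P * satellite_max k r m + satellite_max k r q)"
    unfolding b_def nl nm using q by (simp add: max_eq p algebra_simps)
  have upper: "card E \<le> b" if star: "star_like k l r V E" and n_eq: "card V = n"
    for V :: "'a set" and E :: "'a set set"
  proof -
    from star obtain N SS where SB: "star_built k r V E N SS" and N: "card N = m"
      and sizes: "\<And>S. S \<in> SS \<Longrightarrow> card S = 1 \<or> (r \<le> card S \<and> card S \<le> m)"
      unfolding star_like_def m_def by blast
    note SBc = star_built_card[OF SB r1]
    have total: "sum card SS = P * m + q" using SBc(2) n_eq N nm by simp
    \<comment> \<open>Satellites are nonempty, so \<open>k + (card S choose r)\<close> is one of the
      two terms of the maximum.\<close>
    have "(\<Sum>S\<in>SS. k + (card S choose r)) \<le> (\<Sum>S\<in>SS. satellite_max k r (card S))"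
      using sizes r1 by (intro sum_mono) (force simp: satellite_max_def)
    also have "\<dots> \<le> (sum card SS div m) * satellite_max k r m + satellite_max k r (sum card SS mod m)"
      using sizes m0
      by (intro convex_sum_le satellite_max_convex assms(2) SBc(1)) (force simp: satellite_max_def)+
    also have "\<dots> = P * satellite_max k r m + satellite_max k r q"
      using total q by simp
    finally show ?thesis using SBc(3) N b_eq by simp
  qed
  have exact: "card E = b" if "MSH n k l r V E" for V :: "'a set" and E :: "'a set set"
  proof -
    have pq: "n div m = p" "n mod m = q" using n q by simp_all
    from that obtain N SS where SB: "star_built k r V E N SS" and N: "card N = m"
      and cases: "if m > s
          then if q > s then image_mset card (mset_set SS) = replicate_mset P m + {#q#}
            else image_mset card (mset_set SS) = replicate_mset P m + replicate_mset q 1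
          else image_mset card (mset_set SS) = replicate_mset (n - m) 1"
      unfolding MSH_def Let_def m_def[symmetric] pq nl assms(7)[symmetric] p diff_Suc_1 by blast
    note SBc = star_built_card[OF SB r1]
    have sizes: "image_mset card (mset_set SS) =
        (if m > s then if q > s then replicate_mset P m + {#q#}
           else replicate_mset P m + replicate_mset q 1 else replicate_mset (n - m) 1)"
      using cases by (simp split: if_splits)
    have "(\<Sum>S\<in>SS. k + (card S choose r)) =
        (\<Sum>a\<in>#image_mset card (mset_set SS). k + (a choose r))"
      by (simp add: sum_unfold_sum_mset multiset.map_comp comp_def)
    \<comment> \<open>Since \<open>1 choose r = 0\<close>, a single vertex contributes exactly
      \<open>k\<close>; thus \<open>q\<close> of them reach \<open>satellite_max k r q\<close> when
      \<open>q \<le> s\<close>, and \<open>P * m + q\<close> of them reach the whole sum when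
      \<open>m \<le> s\<close>.\<close>
    also have "\<dots> = P * satellite_max k r m + satellite_max k r q"
      unfolding sizes using assms(2) q nm
      by (auto simp: max_eq algebra_simps)
    finally show ?thesis using SBc(3) N b_eq by simp
  qed
  show ?thesis
    unfolding m_def[symmetric] Let_def b_def[symmetric] using upper exact by blast
qed

end
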